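(* Any face $F$ of $\mathcal{COP}^p$ can be presented in the form $$F=\{D\in\mathcal{COP}^p:\ e_k^\top Dt(i)=0\ \ \forall k\in L(i),\ \forall i\in I\}$$ with some index set $I$, $0\le|I|<\infty$, some vectors $t(i)\in T$, $i\in I$, and some sets $L(i)$ such that $P_+(t(i))\subset L(i)\subset P$ for all $i\in I$.
   Context: Let $p>1$ be an integer, $P=\{1,\dots,p\}$, $e_1,\dots,e_p$ the standard basis of $\mathbb R^p$, $\mathcal S(p)$ the space of real symmetric $p\times p$ matrices, $\mathcal{COP}^p=\{D\in\mathcal S(p): t^\top Dt\ge 0\ \forall t\in\mathbb R^p_+\}$ the cone of copositive matrices, and $T=\{t\in\mathbb R^p_+: \sum_{k\in P}t_k=1\}$. For $t\in\mathbb R^p_+$, $P_+(t)=\{k\in P:t_k>0\}$. A (nonempty) convex subcone $F\subset\mathcal{COP}^p$ is a face of $\mathcal{COP}^p$ if $A,B\in\mathcal{COP}^p$ and $A+B\in F$ imply $A\in F$ and $B\in F$. *)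

theory Defs
  imports "HOL-Analysis.Analysis"
begin

text \<open>The index set \<open>P = {1, \<dots>, p}\<close> is the universe of a finite type \<open>'p\<close> with
  \<open>p = CARD('p)\<close>, and \<open>e\<^sub>k\<close> is \<open>axis k 1\<close>.\<close>

definition symmetric_matrices :: "(real ^ 'p ^ 'p) set" where
  "symmetric_matrices = {D. transpose D = D}"

definition nonneg_orthant :: "(real ^ 'p) set" where
  "nonneg_orthant = {t. \<forall>k. 0 \<le> t $ k}"

definition copositive_cone :: "(real ^ 'p ^ 'p) set" where
  "copositive_cone =
     {D \<in> symmetric_matrices. \<forall>t \<in> nonneg_orthant. 0 \<le> t \<bullet> (D *v t)}"

definition unit_simplex :: "(real ^ 'p) set" where
  "unit_simplex = {t \<in> nonneg_orthant. (\<Sum>k\<in>UNIV. t $ k) = 1}"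

definition pos_support :: "real ^ 'p \<Rightarrow> 'p set" where
  "pos_support t = {k. 0 < t $ k}"

text \<open>\<^const>\<open>convex_cone\<close> includes nonemptiness and closure under scaling by every \<open>c \<ge> 0\<close>.
  Requiring only \<open>c > 0\<close> would define the same faces of a cone \<open>K\<close> containing \<open>0\<close>: from
  \<open>A + 0 \<in> F\<close> the last condition gives \<open>0 \<in> F\<close>.\<close>

definition cone_face :: "'a::real_vector set \<Rightarrow> 'a set \<Rightarrow> bool" where
  "cone_face F K \<longleftrightarrow>
     F \<subseteq> K \<and> convex_cone F \<and>
     (\<forall>A\<in>K. \<forall>B\<in>K. A + B \<in> F \<longrightarrow> A \<in> F \<and> B \<in> F)"

end

theory Submission
  imports Defs
begin

text \<open>Let \<open>D\<close> be a relative interior point of the face \<open>F\<close>, and let \<open>Z\<close> consist of the pairs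
  \<open>(k, t)\<close> with \<open>t \<in> T\<close>, \<open>t\<^sup>T D t = 0\<close> and \<open>(D t)\<^sub>k = 0\<close>. For \<open>A \<in> F\<close>
  also \<open>e D - (e - 1) A\<close> lies in \<open>F\<close> for some \<open>e > 1\<close>; as \<open>A t\<close> and the image of \<open>t\<close> under this matrix
  are both nonnegative, \<open>(A t)\<^sub>k = 0\<close> on \<open>Z\<close>. Conversely, if a copositive \<open>A\<close> satisfies these
  equations, then \<open>t\<^sup>T A t \<le> C t\<^sup>T D t\<close> on the orthant, so \<open>C D\<close> splits into \<open>A\<close> and another
  copositive matrix and \<open>A \<in> F\<close>. The constant \<open>C\<close> comes from an induction on the support \<open>S\<close> of
  \<open>t\<close>. If \<open>D z\<close> vanishes on \<open>S\<close> for some \<open>z \<in> T\<close> supported in \<open>S\<close>, then subtracting multiples of \<open>z\<close>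
  changes neither form, and moves \<open>t\<close> to a proper face. Otherwise \<open>D t\<close> is bounded away from \<open>0\<close> on
  \<open>S\<close>, while a minimiser with full support and negative value of the form of \<open>D - \<epsilon> A\<close> would force
  \<open>D t = O(\<epsilon>)\<close> there. Finitely many of the equations span all of them.\<close>

section \<open>Quadratic forms and faces of the orthant\<close>

lemma inner_matrix_vector_commute:
  fixes M :: "real ^ 'p ^ 'p"
  assumes "transpose M = M"
  shows "x \<bullet> (M *v y) = y \<bullet> (M *v x)"
  by (metis assms dot_lmul_matrix inner_commute transpose_matrix_vector)

lemma quadratic_form_add:
  fixes M :: "real ^ 'p ^ 'p"
  assumes "transpose M = M"
  shows "(x + c *\<^sub>R y) \<bullet> (M *v (x + c *\<^sub>R y))
       = x \<bullet> (M *v x) + 2 * c * (y \<bullet> (M *v x)) + c\<^sup>2 * (y \<bullet> (M *v y))"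
  using inner_matrix_vector_commute[OF assms, of x y]
  by (simp add: matrix_vector_right_distrib inner_add_left inner_add_right
      matrix_vector_mult_scaleR power2_eq_square algebra_simps)

lemma inner_vec_support:
  fixes x y :: "real ^ 'p"
  assumes "\<And>k. x $ k \<noteq> 0 \<Longrightarrow> k \<in> S"
  shows "x \<bullet> y = (\<Sum>k\<in>S. x $ k * y $ k)"
proof -
  have "x \<bullet> y = (\<Sum>k\<in>UNIV. x $ k * y $ k)"
    by (simp add: inner_vec_def)
  also have "\<dots> = (\<Sum>k\<in>S. x $ k * y $ k)"
    by (rule sum.mono_neutral_right) (use assms in auto)
  finally show ?thesis .
qed

text \<open>Coordinates in \<open>S\<close> may vanish as well: this keeps the set closed and lets
  induction on the support run over subsets of \<open>S\<close>.\<close>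

definition face_orthant :: "'p set \<Rightarrow> (real ^ 'p) set" where
  "face_orthant S = {t \<in> nonneg_orthant. \<forall>k. k \<notin> S \<longrightarrow> t $ k = 0}"

lemma face_orthant_UNIV: "face_orthant UNIV = nonneg_orthant"
  by (simp add: face_orthant_def)

lemma face_orthant_support: "t \<in> face_orthant S \<Longrightarrow> t $ k \<noteq> 0 \<Longrightarrow> k \<in> S"
  by (auto simp: face_orthant_def)

lemma face_orthant_nonneg: "t \<in> face_orthant S \<Longrightarrow> 0 \<le> t $ k"
  by (simp add: face_orthant_def nonneg_orthant_def)

section \<open>First-order conditions at zeros of a nonnegative form\<close>

text \<open>A zero is a minimiser on the face, and moving from it along \<open>axis k 1\<close>
  stays in the face, so the form cannot decrease to first order.\<close>

lemma gradient_nonneg_at_zero: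
  fixes M :: "real ^ 'p ^ 'p"
  assumes sym: "transpose M = M"
    and nonneg: "\<And>x. x \<in> face_orthant S \<Longrightarrow> 0 \<le> x \<bullet> (M *v x)"
    and t: "t \<in> face_orthant S" "t \<bullet> (M *v t) = 0" and k: "k \<in> S"
  shows "0 \<le> (M *v t) $ k"
proof (rule ccontr)
  define a where "a = (M *v t) $ k"
  define b where "b = axis k 1 \<bullet> (M *v axis k (1::real))"
  assume "\<not> 0 \<le> (M *v t) $ k"
  then have a: "a < 0" by (simp add: a_def)
  \<comment> \<open>This step length gives \<open>c * b \<le> - a\<close>, so
    \<open>2 * a + c * b \<le> a < 0\<close>.\<close>
  define c where "c = - a / (\<bar>b\<bar> + 1)"
  have c: "c > 0" using a by (simp add: c_def divide_neg_pos)
  have "t + c *\<^sub>R axis k 1 \<in> face_orthant S"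
    using t k c by (auto simp: face_orthant_def nonneg_orthant_def axis_def)
  from nonneg[OF this] have "0 \<le> 2 * c * a + c\<^sup>2 * b"
    by (simp add: quadratic_form_add[OF sym] t a_def b_def inner_axis')
  then have "0 \<le> c * (2 * a + c * b)"
    by (simp add: power2_eq_square algebra_simps)
  then have "0 \<le> 2 * a + c * b"
    using c by (simp add: zero_le_mult_iff)
  moreover have "c * b \<le> c * (\<bar>b\<bar> + 1)"
    using c by (intro mult_left_mono) auto
  moreover have "c * (\<bar>b\<bar> + 1) = - a"
    by (simp add: c_def add_nonneg_eq_0_iff)
  ultimately show False using a by linarith
qed

text \<open>The form at \<open>t\<close> is a sum of products \<open>t $ i * (M *v t) $ i\<close>,
  all nonnegative by the previous lemma; a zero sum makes each product vanish.\<close>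

lemma gradient_zero_at_full_support:
  fixes M :: "real ^ 'p ^ 'p"
  assumes sym: "transpose M = M"
    and nonneg: "\<And>x. x \<in> face_orthant S \<Longrightarrow> 0 \<le> x \<bullet> (M *v x)"
    and t: "t \<in> face_orthant S" "t \<bullet> (M *v t) = 0" and k: "t $ k \<noteq> 0"
  shows "(M *v t) $ k = 0"
proof -
  have "(\<Sum>i\<in>S. t $ i * (M *v t) $ i) = 0"
    using inner_vec_support[of t S "M *v t"] face_orthant_support[OF t(1)] t(2) by simp
  moreover have "0 \<le> t $ i * (M *v t) $ i" if "i \<in> S" for i
    using gradient_nonneg_at_zero[OF sym nonneg t that] face_orthant_nonneg[OF t(1)] by simp
  ultimately have "\<forall>i\<in>S. t $ i * (M *v t) $ i = 0"
    by (subst (asm) sum_nonneg_eq_0_iff) auto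
  then show ?thesis using k face_orthant_support[OF t(1)] by auto
qed

section \<open>Normalisation and minimisers on the simplex\<close>

lemma face_orthant_normalize:
  assumes "t \<in> face_orthant S" "t \<noteq> 0"
  obtains r u where "r > 0" "u \<in> face_orthant S \<inter> unit_simplex" "t = r *\<^sub>R u"
proof -
  define r where "r = (\<Sum>k\<in>UNIV. t $ k)"
  have "r \<ge> 0"
    unfolding r_def by (intro sum_nonneg face_orthant_nonneg[OF assms(1)])
  moreover have "r \<noteq> 0"
  proof
    assume "r = 0"
    then have "\<forall>k. t $ k = 0"
      unfolding r_def by (subst (asm) sum_nonneg_eq_0_iff) (auto simp: face_orthant_nonneg[OF assms(1)])
    then show False using assms(2) by (simp add: vec_eq_iff)
  qed
  ultimately have r: "r > 0" by simp
  have "(\<Sum>k\<in>UNIV. t $ k / r) = 1"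
    using r by (simp flip: sum_divide_distrib r_def)
  then have "(1 / r) *\<^sub>R t \<in> face_orthant S \<inter> unit_simplex"
    using assms r by (auto simp: face_orthant_def unit_simplex_def nonneg_orthant_def)
  then show ?thesis using r by (intro that[of r "(1 / r) *\<^sub>R t"]) auto
qed

lemma unit_simplex_norm_le: "t \<in> unit_simplex \<Longrightarrow> norm t \<le> 1"
  using norm_le_l1_cart[of t] by (simp add: unit_simplex_def nonneg_orthant_def)

lemma compact_face_simplex: "compact (face_orthant S \<inter> unit_simplex)"
proof -
  have "bounded (face_orthant S \<inter> unit_simplex)"
    using unit_simplex_norm_le by (auto simp: bounded_iff)
  moreover have "face_orthant S \<inter> unit_simplex
      = (\<Inter>k. {t. 0 \<le> t $ k}) \<inter> (\<Inter>k\<in>-S. {t. t $ k = 0}) \<inter> {t. (\<Sum>k\<in>UNIV. t $ k) = 1}"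
    by (auto simp: face_orthant_def unit_simplex_def nonneg_orthant_def)
  moreover have "closed \<dots>"
    by (intro closed_Int closed_INT ballI closed_Collect_le closed_Collect_eq continuous_intros)
  ultimately show ?thesis by (simp add: compact_eq_bounded_closed)
qed

lemma continuous_matrix_vector [continuous_intros]:
  fixes M :: "real ^ 'p ^ 'p"
  shows "continuous_on X (\<lambda>x. M *v x)"
  by (simp add: matrix_vector_mul_bounded_linear linear_continuous_on)

text \<open>At a minimiser the form minus \<open>\<lambda> (\<Sum>\<^sub>k t\<^sub>k)\<^sup>2\<close> is nonnegative with a zero at \<open>t\<close>.\<close>

lemma minimizer_on_face_simplex:
  fixes M :: "real ^ 'p ^ 'p"
  assumes sym: "transpose M = M"
    and t: "t \<in> face_orthant S \<inter> unit_simplex" "t $ k \<noteq> 0"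
    and min: "\<And>u. u \<in> face_orthant S \<inter> unit_simplex \<Longrightarrow> t \<bullet> (M *v t) \<le> u \<bullet> (M *v u)"
  shows "(M *v t) $ k = t \<bullet> (M *v t)"
proof -
  define l where "l = t \<bullet> (M *v t)"
  define N where "N = M - (\<chi> i j. l)"
  have N: "N *v x = M *v x - (\<chi> i. l * (\<Sum>k\<in>UNIV. x $ k))" for x
    by (simp add: N_def matrix_vector_mult_diff_rdistrib)
      (simp add: vec_eq_iff matrix_vector_mult_def sum_distrib_left)
  have inner_N: "x \<bullet> (N *v x) = x \<bullet> (M *v x) - l * (\<Sum>k\<in>UNIV. x $ k)\<^sup>2" for x
    by (simp add: N inner_diff_right)
      (simp add: inner_vec_def power2_eq_square sum_distrib_left sum_distrib_right mult_ac)
  have "transpose N = N"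
    using sym by (simp add: N_def transpose_def vec_eq_iff)
  moreover have "0 \<le> x \<bullet> (N *v x)" if "x \<in> face_orthant S" for x
  proof (cases "x = 0")
    case False
    with that obtain r u where r: "r > 0" and u: "u \<in> face_orthant S \<inter> unit_simplex" and x: "x = r *\<^sub>R u"
      by (rule face_orthant_normalize)
    have "0 \<le> u \<bullet> (N *v u)"
      using min[OF u] u by (simp add: inner_N l_def unit_simplex_def)
    then show ?thesis using r by (simp add: x matrix_vector_mult_scaleR)
  qed simp
  moreover have "t \<bullet> (N *v t) = 0"
    using t(1) by (simp add: inner_N l_def unit_simplex_def)
  ultimately have "(N *v t) $ k = 0"
    using gradient_zero_at_full_support[of N S t k] t by simp
  then show ?thesis
    using t(1) by (simp add: N l_def unit_simplex_def)
qed

section \<open>Domination of one copositive form by another\<close>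

lemma copositive_coneD:
  assumes "D \<in> copositive_cone"
  shows "transpose D = D" "t \<in> face_orthant S \<Longrightarrow> 0 \<le> t \<bullet> (D *v t)"
  using assms by (auto simp: copositive_cone_def symmetric_matrices_def face_orthant_def)

lemma inner_zero_on_support:
  fixes x y :: "real ^ 'p"
  assumes "x \<in> face_orthant S" "\<And>k. k \<in> S \<Longrightarrow> y $ k = 0"
  shows "x \<bullet> y = 0"
  using inner_vec_support[of x S y] face_orthant_support[OF assms(1)] assms(2) by simp

text \<open>A ratio test: with \<open>a\<close> the least \<open>t $ k / z $ k\<close> over the
  support of \<open>z\<close>, no coordinate becomes negative and a minimising one becomes
  zero.\<close>

lemma face_orthant_subtract_to_boundary:
  assumes t: "t \<in> face_orthant S" and z: "z \<in> face_orthant S" "z \<noteq> 0"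
  obtains a S' where "S' \<subset> S" "t - a *\<^sub>R z \<in> face_orthant S'"
proof -
  define Q where "Q = {k. z $ k \<noteq> 0}"
  have "Q \<noteq> {}" using z(2) by (auto simp: Q_def vec_eq_iff)
  define m where "m = arg_min_on (\<lambda>k. t $ k / z $ k) Q"
  have m: "m \<in> Q" "\<And>k. k \<in> Q \<Longrightarrow> t $ m / z $ m \<le> t $ k / z $ k"
    using arg_min_if_finite(1)[OF finite \<open>Q \<noteq> {}\<close>] arg_min_least[OF finite \<open>Q \<noteq> {}\<close>]
    by (auto simp: m_def)
  define a where "a = t $ m / z $ m"
  have pos: "z $ k > 0" if "k \<in> Q" for k
    using that face_orthant_nonneg[OF z(1), of k] by (simp add: Q_def)
  have "a * z $ k \<le> t $ k" for k
  proof (cases "k \<in> Q")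
    case True
    then show ?thesis using m(2)[OF True] pos[OF True] by (simp add: a_def pos_le_divide_eq)
  next
    case False
    then show ?thesis using face_orthant_nonneg[OF t] by (simp add: Q_def)
  qed
  moreover have "(t - a *\<^sub>R z) $ m = 0"
    using pos[OF m(1)] by (simp add: a_def)
  ultimately have "t - a *\<^sub>R z \<in> face_orthant (S - {m})"
    using t z by (auto simp: face_orthant_def nonneg_orthant_def)
  moreover have "m \<in> S"
    using m(1) face_orthant_support[OF z(1)] by (simp add: Q_def)
  ultimately show ?thesis by (intro that[of "S - {m}" a]) auto
qed

lemma dominated_on_face_step:
  fixes A D :: "real ^ 'p ^ 'p"
  assumes D: "D \<in> copositive_cone" and A: "A \<in> copositive_cone"
    and C: "C \<ge> 0" "\<And>S' t. S' \<subset> S \<Longrightarrow> t \<in> face_orthant S' \<Longrightarrow> t \<bullet> (A *v t) \<le> C * (t \<bullet> (D *v t))"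
    and no_zero: "\<And>t. t \<in> face_orthant S \<inter> unit_simplex \<Longrightarrow> \<exists>k\<in>S. (D *v t) $ k \<noteq> 0"
  shows "\<exists>C\<ge>0. \<forall>t\<in>face_orthant S. t \<bullet> (A *v t) \<le> C * (t \<bullet> (D *v t))"
proof (cases "face_orthant S \<inter> unit_simplex = {}")
  case True
  then have "t = 0" if "t \<in> face_orthant S" for t
    using face_orthant_normalize[OF that] by fastforce
  then have "\<forall>t\<in>face_orthant S. t \<bullet> (A *v t) \<le> 0 * (t \<bullet> (D *v t))" by fastforce
  then show ?thesis by blast
next
  case False
  let ?T = "face_orthant S \<inter> unit_simplex"
  \<comment> \<open>By \<open>no_zero\<close> and compactness, this l1 norm of \<open>D *v t\<close>
    on \<open>S\<close> has a positive minimum.\<close>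
  define \<phi> where "\<phi> t = (\<Sum>k\<in>S. \<bar>(D *v t) $ k\<bar>)" for t
  have "continuous_on ?T \<phi>"
    unfolding \<phi>_def by (intro continuous_intros)
  then obtain z where z: "z \<in> ?T" "\<And>t. t \<in> ?T \<Longrightarrow> \<phi> z \<le> \<phi> t"
    using continuous_attains_inf[OF compact_face_simplex False] by metis
  have "\<phi> z > 0"
  proof -
    obtain k where k: "k \<in> S" "(D *v z) $ k \<noteq> 0" using no_zero[OF z(1)] by blast
    then show ?thesis unfolding \<phi>_def by (intro sum_pos2[of S k]) auto
  qed
  obtain K where K: "K > 0" "\<And>x. norm (A *v x) \<le> norm x * K"
    using bounded_linear.pos_bounded[OF matrix_vector_mul_bounded_linear[of A]] by metis
  have KA: "norm (A *v t) \<le> K" if "t \<in> ?T" for t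
  proof -
    have "norm t * K \<le> 1 * K"
      using unit_simplex_norm_le[of t] that K(1) by (intro mult_right_mono) auto
    then show ?thesis using K(2)[of t] by linarith
  qed
  \<comment> \<open>The first bound makes the form of \<open>D - e *\<^sub>R A\<close> nonnegative
    on proper faces; the second contradicts the minimum of \<open>\<phi>\<close> if that form is
    negative somewhere. The \<open>+ 1\<close> in the second denominator also makes
    \<open>e\<phi>\<close> strict.\<close>
  define e where "e = min (1 / (C + 1)) (\<phi> z / (2 * K * card S + 1))"
  have e: "e > 0" using C(1) \<open>\<phi> z > 0\<close> K(1) by (simp add: e_def add_nonneg_pos)
  have eC: "e * C \<le> 1"
  proof -
    have "e * (C + 1) \<le> 1"
      using C(1) by (subst pos_le_divide_eq[symmetric]) (auto simp: e_def)
    then show ?thesis using e by (simp add: algebra_simps)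
  qed
  have e\<phi>: "e * (2 * K * card S) < \<phi> z"
  proof -
    have "e * (2 * K * card S + 1) \<le> \<phi> z"
      using K(1) by (subst pos_le_divide_eq[symmetric]) (auto simp: e_def add_nonneg_pos)
    then show ?thesis using e by (simp add: algebra_simps)
  qed
  define M where "M = D - e *\<^sub>R A"
  have Mv: "M *v x = D *v x - e *\<^sub>R (A *v x)" for x
    by (simp add: M_def matrix_vector_mult_diff_rdistrib scaleR_matrix_vector_assoc)
  have symM: "transpose M = M"
    using copositive_coneD(1)[OF D] copositive_coneD(1)[OF A]
    by (simp add: M_def transpose_def vec_eq_iff)
  have "continuous_on ?T (\<lambda>t. t \<bullet> (M *v t))"
    by (intro continuous_intros)
  then obtain t where t: "t \<in> ?T" "\<And>u. u \<in> ?T \<Longrightarrow> t \<bullet> (M *v t) \<le> u \<bullet> (M *v u)"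
    using continuous_attains_inf[OF compact_face_simplex False] by metis
  have nonneg: "0 \<le> t \<bullet> (M *v t)"
  proof (rule ccontr)
    define l where "l = t \<bullet> (M *v t)"
    assume neg: "\<not> 0 \<le> t \<bullet> (M *v t)"
    have full: "t $ k \<noteq> 0" if "k \<in> S" for k
    proof
      assume "t $ k = 0"
      then have "t \<in> face_orthant (S - {k})"
        using t(1) by (auto simp: face_orthant_def)
      then have "t \<bullet> (A *v t) \<le> C * (t \<bullet> (D *v t))"
        using that by (intro C(2)[of "S - {k}"]) auto
      then have "e * (t \<bullet> (A *v t)) \<le> (e * C) * (t \<bullet> (D *v t))"
        using e by simp
      also have "\<dots> \<le> 1 * (t \<bullet> (D *v t))"
        using eC t(1) by (intro mult_right_mono copositive_coneD(2)[OF D, of t S]) auto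
      finally show False using neg by (simp add: Mv inner_diff_right)
    qed
    have lb: "- (e * K) \<le> l"
    proof -
      have "t \<bullet> (A *v t) \<le> norm t * norm (A *v t)" by (rule norm_cauchy_schwarz)
      also have "\<dots> \<le> 1 * K"
        using KA[OF t(1)] t(1) unit_simplex_norm_le[of t] by (intro mult_mono) auto
      finally have "e * (t \<bullet> (A *v t)) \<le> e * K" using e by simp
      then show ?thesis
        using copositive_coneD(2)[OF D, of t S] t(1) by (simp add: l_def Mv inner_diff_right)
    qed
    \<comment> \<open>At the fully supported minimiser \<open>M *v t\<close> equals \<open>l\<close>
      throughout \<open>S\<close>, so \<open>D *v t\<close> is there a sum of two terms of size at
      most \<open>e * K\<close>.\<close>
    have "\<bar>(D *v t) $ k\<bar> \<le> 2 * (e * K)" if "k \<in> S" for k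
    proof -
      have "(M *v t) $ k = l"
        using minimizer_on_face_simplex[OF symM t(1) full[OF that] t(2)] by (simp add: l_def)
      then have "(D *v t) $ k = l + e * (A *v t) $ k" by (simp add: Mv)
      moreover have "\<bar>e * (A *v t) $ k\<bar> \<le> e * K"
        using component_le_norm_cart[of "A *v t" k] KA[OF t(1)] e by (simp add: abs_mult)
      ultimately show ?thesis using lb neg unfolding l_def by linarith
    qed
    then have "\<phi> t \<le> (\<Sum>k\<in>S. 2 * (e * K))"
      unfolding \<phi>_def by (intro sum_mono) auto
    also have "\<dots> = e * (2 * K * card S)" by simp
    finally show False using e\<phi> z(2)[OF t(1)] by linarith
  qed
  \<comment> \<open>Both forms are homogeneous of degree 2, so the simplex suffices.\<close>
  have "x \<bullet> (A *v x) \<le> (1 / e) * (x \<bullet> (D *v x))" if "x \<in> face_orthant S" for x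
  proof (cases "x = 0")
    case False
    with that obtain r u where r: "r > 0" and u: "u \<in> ?T" and x: "x = r *\<^sub>R u"
      by (rule face_orthant_normalize)
    have "0 \<le> u \<bullet> (M *v u)" using nonneg t(2)[OF u] by linarith
    then have "u \<bullet> (A *v u) \<le> (1 / e) * (u \<bullet> (D *v u))"
      using e by (simp add: Mv inner_diff_right field_simps)
    then have "r\<^sup>2 * (u \<bullet> (A *v u)) \<le> r\<^sup>2 * ((1 / e) * (u \<bullet> (D *v u)))"
      by (intro mult_left_mono) auto
    then show ?thesis
      by (simp add: x matrix_vector_mult_scaleR power2_eq_square mult_ac)
  qed simp
  then show ?thesis using e by (intro exI[of _ "1 / e"]) auto
qed

lemma dominated_on_face:
  fixes A D :: "real ^ 'p ^ 'p"
  assumes D: "D \<in> copositive_cone" and A: "A \<in> copositive_cone"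
    and zero: "\<And>t k. t \<in> unit_simplex \<Longrightarrow> t \<bullet> (D *v t) = 0 \<Longrightarrow> (D *v t) $ k = 0 \<Longrightarrow> (A *v t) $ k = 0"
  shows "\<exists>C\<ge>0. \<forall>t\<in>face_orthant S. t \<bullet> (A *v t) \<le> C * (t \<bullet> (D *v t))"
proof (induction S rule: finite_psubset_induct[OF finite])
  case (1 S)
  then have "\<forall>S'. \<exists>c. S' \<subset> S \<longrightarrow> c \<ge> 0 \<and> (\<forall>t\<in>face_orthant S'. t \<bullet> (A *v t) \<le> c * (t \<bullet> (D *v t)))"
    by blast
  from choice[OF this] obtain c where c: "\<And>S'. S' \<subset> S \<Longrightarrow> c S' \<ge> 0"
    "\<And>S' t. S' \<subset> S \<Longrightarrow> t \<in> face_orthant S' \<Longrightarrow> t \<bullet> (A *v t) \<le> c S' * (t \<bullet> (D *v t))"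
    by blast
  \<comment> \<open>The constants are nonnegative, so their sum serves all proper subsets at
    once.\<close>
  define C where "C = (\<Sum>S'\<in>{S'. S' \<subset> S}. c S')"
  have C0: "C \<ge> 0" unfolding C_def using c(1) by (intro sum_nonneg) auto
  have C: "t \<bullet> (A *v t) \<le> C * (t \<bullet> (D *v t))" if "S' \<subset> S" "t \<in> face_orthant S'" for S' t
  proof -
    have "c S' \<le> C" unfolding C_def
      using c(1) that by (intro member_le_sum) auto
    then have "c S' * (t \<bullet> (D *v t)) \<le> C * (t \<bullet> (D *v t))"
      by (intro mult_right_mono copositive_coneD(2)[OF D that(2)])
    then show ?thesis using c(2)[OF that] by linarith
  qed
  show ?case
  proof (cases "\<exists>z\<in>face_orthant S \<inter> unit_simplex. \<forall>k\<in>S. (D *v z) $ k = 0")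
    case False
    then show ?thesis by (intro dominated_on_face_step[OF D A C0 C]) auto
  next
    case True
    then obtain z where z: "z \<in> face_orthant S" "z \<in> unit_simplex" and Dz: "\<And>k. k \<in> S \<Longrightarrow> (D *v z) $ k = 0"
      by auto
    have Az: "(A *v z) $ k = 0" if "k \<in> S" for k
      using zero[OF z(2) inner_zero_on_support[OF z(1) Dz] Dz[OF that]] by simp
    \<comment> \<open>\<open>M *v z\<close> vanishes on \<open>S\<close>, which contains the
      supports of \<open>t\<close> and \<open>z\<close>, so the cross term and the square term are
      both zero.\<close>
    have shift: "(t - a *\<^sub>R z) \<bullet> (M *v (t - a *\<^sub>R z)) = t \<bullet> (M *v t)"
      if "t \<in> face_orthant S" "transpose M = M" "\<And>k. k \<in> S \<Longrightarrow> (M *v z) $ k = 0"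
      for M :: "real ^ 'p ^ 'p" and a t
      using quadratic_form_add[OF that(2), of t "- a" z] inner_zero_on_support[OF that(1,3)]
        inner_zero_on_support[OF z(1) that(3)] inner_matrix_vector_commute[OF that(2), of z t]
      by simp
    have "t \<bullet> (A *v t) \<le> C * (t \<bullet> (D *v t))" if t: "t \<in> face_orthant S" for t
    proof -
      have "z \<noteq> 0" using z(2) by (auto simp: unit_simplex_def)
      with t z(1) obtain a S' where "S' \<subset> S" "t - a *\<^sub>R z \<in> face_orthant S'"
        by (rule face_orthant_subtract_to_boundary)
      from C[OF this] show ?thesis
        by (simp only: shift[OF t copositive_coneD(1)[OF A] Az] shift[OF t copositive_coneD(1)[OF D] Dz])
    qed
    then show ?thesis using C0 by blast
  qed
qed

section \<open>Faces as solution sets of linear equations\<close>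

text \<open>The matrix with row \<open>k\<close> equal to \<open>t\<close> and all other rows zero
  represents an equation of the theorem as orthogonality to \<open>D\<close>.\<close>

lemma inner_axis_matrix:
  fixes D :: "real ^ 'p ^ 'p"
  shows "axis k t \<bullet> D = (D *v t) $ k"
proof -
  have "axis k t \<bullet> D = t \<bullet> (D $ k)"
    by (rule inner_axis')
  then show ?thesis
    by (simp add: matrix_vector_mul_component inner_commute)
qed

lemma scaled_difference_copositive:
  assumes D: "D \<in> copositive_cone" and A: "A \<in> copositive_cone"
    and dom: "\<forall>t\<in>nonneg_orthant. t \<bullet> (A *v t) \<le> C * (t \<bullet> (D *v t))"
  shows "C *\<^sub>R D - A \<in> copositive_cone"
  using assms
  by (auto simp: copositive_cone_def symmetric_matrices_def transpose_def vec_eq_iff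
      matrix_vector_mult_diff_rdistrib inner_diff_right simp flip: scaleR_matrix_vector_assoc)

lemma cone_face_zero_equations:
  fixes F :: "(real ^ 'p ^ 'p) set"
  assumes F: "cone_face F copositive_cone"
  obtains D where "D \<in> copositive_cone"
    "F = {A \<in> copositive_cone. \<forall>t\<in>unit_simplex. t \<bullet> (D *v t) = 0 \<longrightarrow>
            (\<forall>k. (D *v t) $ k = 0 \<longrightarrow> (A *v t) $ k = 0)}"
proof -
  have sub: "F \<subseteq> copositive_cone" and cone: "convex_cone F"
    and face: "\<And>A B. A \<in> copositive_cone \<Longrightarrow> B \<in> copositive_cone \<Longrightarrow> A + B \<in> F \<Longrightarrow> A \<in> F"
    using F by (auto simp: cone_face_def)
  from cone have conv: "convex F" and ne: "F \<noteq> {}" and scale: "\<And>A c. A \<in> F \<Longrightarrow> 0 \<le> c \<Longrightarrow> c *\<^sub>R A \<in> F"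
    by (auto simp: convex_cone_def conic_def)
  obtain D where D: "D \<in> rel_interior F"
    using rel_interior_eq_empty[OF conv] ne by auto
  then have DF: "D \<in> F" using rel_interior_subset by blast
  then have Dc: "D \<in> copositive_cone" using sub by auto
  show thesis
  proof (rule that[OF Dc], intro equalityI subsetI CollectI conjI ballI impI allI)
    fix A assume A: "A \<in> F"
    then show Ac: "A \<in> copositive_cone" using sub by auto
    fix t k assume t: "t \<in> unit_simplex" and Dt: "t \<bullet> (D *v t) = 0" and Dk: "(D *v t) $ k = 0"
    have tn: "t \<in> face_orthant UNIV" using t by (simp add: face_orthant_UNIV unit_simplex_def)
    \<comment> \<open>The segment from \<open>A\<close> to \<open>D\<close> can be prolonged beyond
      \<open>D\<close> inside \<open>F\<close>, which gives \<open>A\<close> a negative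
      coefficient.\<close>
    obtain e where e: "e > 1" "(1 - e) *\<^sub>R A + e *\<^sub>R D \<in> F"
      using convex_rel_interior_iff[OF conv ne] D A by auto
    define B where "B = (1 - e) *\<^sub>R A + e *\<^sub>R D"
    have Bc: "B \<in> copositive_cone" using e sub by (auto simp: B_def)
    have Bv: "B *v t = (1 - e) *\<^sub>R (A *v t) + e *\<^sub>R (D *v t)"
      by (simp add: B_def matrix_vector_mult_add_rdistrib scaleR_matrix_vector_assoc)
    have "(e - 1) * (t \<bullet> (A *v t)) \<le> 0"
      using copositive_coneD(2)[OF Bc tn] by (simp add: Bv inner_add_right Dt algebra_simps)
    then have "t \<bullet> (A *v t) \<le> 0"
      using e(1) by (simp add: mult_le_0_iff)
    then have At: "t \<bullet> (A *v t) = 0"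
      using copositive_coneD(2)[OF Ac tn] by simp
    then have Bt: "t \<bullet> (B *v t) = 0" by (simp add: Bv inner_add_right Dt)
    have "0 \<le> (A *v t) $ k"
      using gradient_nonneg_at_zero[OF copositive_coneD[OF Ac] tn At] by simp
    moreover have "0 \<le> (B *v t) $ k"
      using gradient_nonneg_at_zero[OF copositive_coneD[OF Bc] tn Bt] by simp
    then have "(e - 1) * (A *v t) $ k \<le> 0" by (simp add: Bv Dk algebra_simps)
    then have "(A *v t) $ k \<le> 0" using e(1) by (simp add: mult_le_0_iff)
    ultimately show "(A *v t) $ k = 0" by simp
  next
    fix A assume "A \<in> {A \<in> copositive_cone. \<forall>t\<in>unit_simplex. t \<bullet> (D *v t) = 0 \<longrightarrow>
            (\<forall>k. (D *v t) $ k = 0 \<longrightarrow> (A *v t) $ k = 0)}"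
    then have Ac: "A \<in> copositive_cone"
      and zero: "\<And>t k. t \<in> unit_simplex \<Longrightarrow> t \<bullet> (D *v t) = 0 \<Longrightarrow> (D *v t) $ k = 0 \<Longrightarrow> (A *v t) $ k = 0"
      by auto
    obtain C where C: "C \<ge> 0" "\<forall>t\<in>face_orthant UNIV. t \<bullet> (A *v t) \<le> C * (t \<bullet> (D *v t))"
      using dominated_on_face[OF Dc Ac zero] by blast
    have "C *\<^sub>R D - A \<in> copositive_cone"
      using C(2) by (intro scaled_difference_copositive Dc Ac) (simp add: face_orthant_UNIV)
    \<comment> \<open>The two copositive summands \<open>A\<close> and
      \<open>C *\<^sub>R D - A\<close> add up to a multiple of \<open>D\<close>, which lies in
      \<open>F\<close>.\<close>
    then show "A \<in> F"
      using face[OF Ac, of "C *\<^sub>R D - A"] scale[OF DF C(1)] by simp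
  qed
qed

theorem corollary2:
  fixes F :: "(real ^ 'p ^ 'p) set"
  assumes "1 < CARD('p)"
    and "cone_face F copositive_cone"
  shows "\<exists>(I :: nat set) (t :: nat \<Rightarrow> real ^ 'p) (L :: nat \<Rightarrow> 'p set).
           finite I \<and>
           (\<forall>i\<in>I. t i \<in> unit_simplex \<and> pos_support (t i) \<subseteq> L i) \<and>
           F = {D \<in> copositive_cone. \<forall>i\<in>I. \<forall>k\<in>L i. axis k 1 \<bullet> (D *v t i) = 0}"
proof -
  obtain D where Dc: "D \<in> copositive_cone" and F: "F = {A \<in> copositive_cone.
      \<forall>t\<in>unit_simplex. t \<bullet> (D *v t) = 0 \<longrightarrow> (\<forall>k. (D *v t) $ k = 0 \<longrightarrow> (A *v t) $ k = 0)}"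
    using assms(2) by (rule cone_face_zero_equations)
  define Z where "Z = {t \<in> unit_simplex. t \<bullet> (D *v t) = 0}"
  define L0 where "L0 t = {k. (D *v t) $ k = 0}" for t
  \<comment> \<open>These are the coefficient matrices of all the equations; a basis of their span
    is finite.\<close>
  define W where "W = (\<lambda>(t, k). axis k t) ` (SIGMA t:Z. L0 t)"
  obtain B where B: "B \<subseteq> W" "independent B" "W \<subseteq> span B"
    using maximal_independent_subset[of W] by blast
  have "finite B" using B(2) by (rule independent_imp_finite)
  then obtain Q where Q: "Q \<subseteq> (SIGMA t:Z. L0 t)" "finite Q" "B = (\<lambda>(t, k). axis k t) ` Q"
    using B(1) unfolding W_def by (metis finite_subset_image)
  \<comment> \<open>Only the vectors of the chosen pairs are kept, each with its full set
    \<open>L0\<close>: the extra equations hold on \<open>F\<close>, and \<open>L0\<close> contains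
    the support. If \<open>Q\<close> is empty, then \<open>n = 0\<close>.\<close>
  obtain h :: "nat \<Rightarrow> real ^ 'p" and n where h: "fst ` Q = h ` {i. i < n}"
    using finite_imp_nat_seg_image_inj_on[of "fst ` Q"] Q(2) by auto
  have hZ: "h i \<in> Z" if "i < n" for i
    using h that Q(1) by fastforce
  have F': "F = {A \<in> copositive_cone. \<forall>i\<in>{i. i < n}. \<forall>k\<in>L0 (h i). axis k 1 \<bullet> (A *v h i) = 0}"
  proof (intro equalityI subsetI CollectI conjI ballI)
    fix A i k assume "A \<in> F" "i \<in> {i. i < n}" "k \<in> L0 (h i)"
    then show "axis k 1 \<bullet> (A *v h i) = 0"
      using hZ[of i] by (auto simp: F Z_def L0_def inner_axis')
  next
    fix A assume "A \<in> {A \<in> copositive_cone. \<forall>i\<in>{i. i < n}. \<forall>k\<in>L0 (h i). axis k 1 \<bullet> (A *v h i) = 0}"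
    then have Ac: "A \<in> copositive_cone"
      and zero: "\<And>i k. i < n \<Longrightarrow> k \<in> L0 (h i) \<Longrightarrow> (A *v h i) $ k = 0"
      by (auto simp: inner_axis')
    have "orthogonal A b" if "b \<in> B" for b
    proof -
      obtain t k where tk: "(t, k) \<in> Q" "b = axis k t" using \<open>b \<in> B\<close> Q(3) by auto
      then obtain i where "i < n" "t = h i" using h by (force simp: image_iff)
      then show ?thesis
        using zero[of i k] tk Q(1) by (auto simp: orthogonal_def inner_axis_matrix inner_commute[of A])
    qed
    then have "orthogonal A w" if "w \<in> W" for w
      using orthogonal_to_span[of w B A] B(3) that by blast
    then have "(A *v t) $ k = 0" if "t \<in> Z" "k \<in> L0 t" for t k
      using that by (force simp: W_def orthogonal_def inner_commute[of A] inner_axis_matrix)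
    then show "A \<in> F" using Ac by (auto simp: F Z_def L0_def)
  qed (simp add: F)
  have "h i \<in> unit_simplex \<and> pos_support (h i) \<subseteq> L0 (h i)" if "i < n" for i
  proof -
    have "h i \<in> face_orthant UNIV" "h i \<bullet> (D *v h i) = 0"
      using hZ[OF that] by (auto simp: Z_def unit_simplex_def face_orthant_UNIV)
    from gradient_zero_at_full_support[OF copositive_coneD[OF Dc] this] show ?thesis
      using hZ[OF that] by (auto simp: Z_def pos_support_def L0_def)
  qed
  with F' show ?thesis
    by (intro exI[of _ "{i. i < n}"] exI[of _ h] exI[of _ "\<lambda>i. L0 (h i)"]) auto
qed

end
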